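(* Let $\Bbbk$ be a field, a unique factorization domain or a principal ideal domain. The Rheinfall algorithm (the message-passing Gaussian Elimination procedure described in the context) reduces any given input matrix $A$ with entries in $\Bbbk$ to row echelon form in finite time.
   Context: Row and column indices are $0$-based: $A = (a_{ij})$, $i = 0, \ldots, n-1$, $j = 0, \ldots, m-1$, is an $n \times m$ matrix, given as a list of rows $r_i$. **Row echelon form.** Let $z_i := \min\{ j : a_{ij} \neq 0\}$ be the column index of the first nonzero entry in the $i$-th row of $A$; for a null row, $z_i := m$. The $i$-th row is said to start at column $z_i$. The matrix is in row echelon form iff, for all $i = 1, \ldots, n-1$, either $z_i > z_{i-1}$ or $z_i = m$. **Rheinfall algorithm.** A master process starts $m$ processing units $P[0], \ldots, P[m-1]$, one for each column of $A$, which run concurrently; $P[c]$ handles rows starting at column $c$. A unit can send messages to every other unit. Messages are of two sorts: Row messages, whose payload (when received by $P[c]$) is a matrix row extending from column $c$ to $m-1$, and End messages, which carry no payload and signal the unit to finalize its computation and stop. In order to guarantee that the End message is the last message a running unit can receive, two assumptions are made: (1) messages sent from one unit to another arrive in the order in which they were sent; (2) a unit can wait until all the messages it has sent have been delivered. *Master procedure, on input $A$:* start a unit $P[c]$ for each column $c$ of $A$; for each $i \in \{0, \ldots, n-1\}$, let $c$ be the first nonzero column of $r_i$ and send $r_i$ to $P[c]$; send an End message to $P[0]$; wait until $P[m-1]$ receives an End message; collect the outputs from all units and return them as the result. *Procedure run by unit $P[c]$:* initially $u$ is nil, $Q$ is the empty list, the output is nil and the state is "running". While the state is "running", repeat: 1.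 Wait for messages to arrive; append Row messages to $Q$. 2. Select the best pivot row $t$ from $Q$. If $u$ is nil, set $u = t$; else, if $t$ has a better pivot than $u$, exchange $u$ and $t$. 3. For each row $r$ in $Q$: compute $r' = \mathrm{eliminate}(r,u)$; let $c'$ be the first nonzero column of $r'$; send $r'$ to $P[c']$; delete $r$ from $Q$. 4. If an End message has been received: wait for all sent messages to arrive, set the output to $u$, send End to $P[c+1]$, and set the state to "done". When the state is "done", the unit returns its output to the master. Here $\mathrm{eliminate}(r,u)$ returns a row $r' = \alpha r + \beta u$ with $\alpha, \beta \in \Bbbk$ chosen so that $r'$ has a $0$ entry in all columns $j \le c$; its actual definition depends on the coefficient ring $\Bbbk$. By construction $u[c] \neq 0$.
   Formalization: That the result keeps the row space of A (over the fraction field) is claimed only if eliminate uses a nonzero α and the master waits for delivery of its rows before sending End; otherwise rows can be lost. Termination and echelon form are claimed without these conditions. *)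

theory Defs
  imports "HOL-Algebra.Ring_Divisibility" "Jordan_Normal_Form.Matrix"
begin

text \<open>Matrices and rows are the containers \<open>'a mat\<close> and \<open>'a vec\<close>; the coefficient ring is an
  explicit HOL-Algebra structure \<open>R\<close>, so that field, UFD and PID are properties of one object.\<close>

definition start_col :: "('a, 'b) ring_scheme \<Rightarrow> 'a vec \<Rightarrow> nat" where
  "start_col R r = (if \<exists>j < dim_vec r. r $ j \<noteq> \<zero>\<^bsub>R\<^esub>
                    then (LEAST j. j < dim_vec r \<and> r $ j \<noteq> \<zero>\<^bsub>R\<^esub>)
                    else dim_vec r)"

definition row_echelon :: "('a, 'b) ring_scheme \<Rightarrow> 'a mat \<Rightarrow> bool" where
  "row_echelon R B \<longleftrightarrow>
     (\<forall>i \<in> {1..<dim_row B}. start_col R (row B i) > start_col R (row B (i - 1))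
                          \<or> start_col R (row B i) = dim_col B)"

definition rows_over :: "('a, 'b) ring_scheme \<Rightarrow> nat \<Rightarrow> 'a vec set" where
  "rows_over R m = {r \<in> carrier_vec m. \<forall>j < m. r $ j \<in> carrier R}"

definition row_comb :: "('a, 'b) ring_scheme \<Rightarrow> nat \<Rightarrow> 'a \<Rightarrow> 'a vec \<Rightarrow> 'a \<Rightarrow> 'a vec \<Rightarrow> 'a vec" where
  "row_comb R m \<alpha> r \<beta> u = vec m (\<lambda>j. \<alpha> \<otimes>\<^bsub>R\<^esub> r $ j \<oplus>\<^bsub>R\<^esub> \<beta> \<otimes>\<^bsub>R\<^esub> u $ j)"

definition row_module :: "('a, 'b) ring_scheme \<Rightarrow> 'a mat \<Rightarrow> 'a vec set" where
  "row_module R B =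
     {vec (dim_col B) (\<lambda>j. \<Oplus>\<^bsub>R\<^esub>i \<in> {..<dim_row B}. x i \<otimes>\<^bsub>R\<^esub> B $$ (i, j)) | x.
        x \<in> {..<dim_row B} \<rightarrow> carrier R}"

text \<open>For an integral domain \<open>R\<close> with \<open>set (rows B) \<subseteq> row_module R A\<close>, the next condition says that
  \<open>A\<close> and \<open>B\<close> have the same row space over the field of fractions of \<open>R\<close>; a denominator is
  unavoidable, because the multipliers used by an elimination step need not be units.\<close>

definition rows_recoverable :: "('a, 'b) ring_scheme \<Rightarrow> 'a mat \<Rightarrow> 'a mat \<Rightarrow> bool" where
  "rows_recoverable R A B \<longleftrightarrow>
     (\<forall>r \<in> set (rows A). \<exists>d \<in> carrier R - {\<zero>\<^bsub>R\<^esub>}.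
        vec (dim_col A) (\<lambda>j. d \<otimes>\<^bsub>R\<^esub> r $ j) \<in> row_module R B)"

text \<open>\<open>elim\<close> is a parameter, as it depends on the ring; it is only constrained on the arguments
  a unit can pass to it. \<open>K\<close> is the set of admissible values for the multiplier of the eliminated
  row: \<open>K = carrier R\<close> is the bare requirement (under which a row may be discarded by choosing
  \<open>\<alpha> = \<beta> = 0\<close>), and \<open>K = carrier R - {0}\<close> excludes that degenerate choice.\<close>

definition eliminates ::
    "('a, 'b) ring_scheme \<Rightarrow> nat \<Rightarrow> 'a set \<Rightarrow> ('a vec \<Rightarrow> 'a vec \<Rightarrow> 'a vec) \<Rightarrow> bool" where
  "eliminates R m K elim \<longleftrightarrow>
     (\<forall>c < m. \<forall>r \<in> rows_over R m. \<forall>u \<in> rows_over R m.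
        start_col R r = c \<longrightarrow> start_col R u = c \<longrightarrow>
        (\<exists>\<alpha> \<in> K. \<exists>\<beta> \<in> carrier R. elim r u = row_comb R m \<alpha> r \<beta> u) \<and>
        (\<forall>j \<le> c. elim r u $ j = \<zero>\<^bsub>R\<^esub>))"

datatype sender = Master | Proc nat

text \<open>A Row message for \<open>P[c]\<close> carries the full row of length \<open>m\<close>; its entries before column
  \<open>c\<close> are zero, so this is the row extending from column \<open>c\<close> to \<open>m - 1\<close>.\<close>

datatype 'a msg = Row "'a vec" | End

text \<open>\<open>Receive\<close>, \<open>Select\<close>, \<open>Eliminate\<close>, \<open>Check\<close> are the program points of steps 1 to 4 of a
  running unit.\<close>

datatype phase = Receive | Select | Eliminate | Check | Done

text \<open>A message that has arrived at (was delivered to) a unit sits in its \<open>inbox\<close> until the unit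
  next executes its receiving step; \<open>ended\<close> records that an End message has been received.\<close>

record 'a proc_unit =
  phase :: phase
  pivot :: "'a vec option"
  queue :: "'a vec list"
  outp  :: "'a vec option"
  ended :: bool
  inbox :: "'a msg list"

text \<open>\<open>Sending i\<close>: rows \<open>0, \<dots>, i - 1\<close> have been sent. \<open>Returned os\<close> lists the outputs of
  \<open>P[0], \<dots>, P[m - 1]\<close>, \<open>None\<close> standing for nil.\<close>

datatype 'a master_state = Sending nat | Awaiting_End | Collecting | Returned "'a vec option list"

text \<open>\<open>chan s p c\<close> is the FIFO sequence of messages in transit from \<open>p\<close> to \<open>P[c]\<close>.\<close>

record 'a config =
  master :: "'a master_state"
  proc   :: "nat \<Rightarrow> 'a proc_unit"
  chan   :: "sender \<Rightarrow> nat \<Rightarrow> 'a msg list"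

definition initial :: "'a config" where
  "initial =
     \<lparr>master = Sending 0,
      proc = (\<lambda>c. \<lparr>phase = Receive, pivot = None, queue = [], outp = None,
                   ended = False, inbox = []\<rparr>),
      chan = (\<lambda>p c. [])\<rparr>"

text \<open>There is no unit \<open>P[m]\<close>: null rows, for which the start column is \<open>m\<close>, and the End message
  emitted by the last unit are dropped.\<close>

definition send :: "nat \<Rightarrow> sender \<Rightarrow> nat \<Rightarrow> 'a msg \<Rightarrow> 'a config \<Rightarrow> 'a config" where
  "send m p c M s =
     (if c < m then s\<lparr>chan := (chan s)(p := (chan s p)(c := chan s p c @ [M]))\<rparr> else s)"

definition all_delivered :: "sender \<Rightarrow> 'a config \<Rightarrow> bool" where
  "all_delivered p s \<longleftrightarrow> (\<forall>c. chan s p c = [])"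

abbreviation upd_proc :: "nat \<Rightarrow> ('a proc_unit \<Rightarrow> 'a proc_unit) \<Rightarrow> 'a config \<Rightarrow> 'a config" where
  "upd_proc c f s \<equiv> s\<lparr>proc := (proc s)(c := f (proc s c))\<rparr>"

definition best :: "('r \<Rightarrow> 'r \<Rightarrow> bool) \<Rightarrow> 'r \<Rightarrow> 'r list \<Rightarrow> bool" where
  "best better t Q \<longleftrightarrow> t \<in> set Q \<and> (\<forall>r \<in> set Q. \<not> better r t)"

text \<open>One atomic step of some actor (master, network, or unit). Actors interleave arbitrarily; no
  fairness is built in. \<open>better c t u\<close> means that for \<open>P[c]\<close> the row \<open>t\<close> has a better pivot
  than \<open>u\<close>. When \<open>u\<close> is nil, the selected row moves from the queue to \<open>u\<close>.

  \<open>flush\<close> tells whether the master, as every unit does, waits for delivery of the Row messages it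
  has sent before it sends End to \<open>P[0]\<close>. Without this, End may overtake a row of the input: \<open>P[0]\<close>
  can pass End on to \<open>P[1]\<close> while a row from the master to \<open>P[1]\<close> is still in transit, which
  first-in-first-out order on each channel does not prevent.\<close>

inductive step ::
  "('a, 'b) ring_scheme \<Rightarrow> ('a vec \<Rightarrow> 'a vec \<Rightarrow> 'a vec) \<Rightarrow> (nat \<Rightarrow> 'a vec \<Rightarrow> 'a vec \<Rightarrow> bool) \<Rightarrow>
   bool \<Rightarrow> 'a mat \<Rightarrow> 'a config \<Rightarrow> 'a config \<Rightarrow> bool"
  for R elim better flush A where
  master_send_row:
    "\<lbrakk>master s = Sending i; i < dim_row A\<rbrakk>
     \<Longrightarrow> step R elim better flush A s
           (send (dim_col A) Master (start_col R (row A i)) (Row (row A i))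
              (s\<lparr>master := Sending (Suc i)\<rparr>))"
| master_send_end:
    "\<lbrakk>master s = Sending (dim_row A); flush \<longrightarrow> all_delivered Master s\<rbrakk>
     \<Longrightarrow> step R elim better flush A s
           (send (dim_col A) Master 0 End (s\<lparr>master := Awaiting_End\<rparr>))"
| master_await_end:
    "\<lbrakk>master s = Awaiting_End; dim_col A > 0 \<longrightarrow> ended (proc s (dim_col A - 1))\<rbrakk>
     \<Longrightarrow> step R elim better flush A s (s\<lparr>master := Collecting\<rparr>)"
| master_collect:
    "\<lbrakk>master s = Collecting; \<forall>c < dim_col A. phase (proc s c) = Done\<rbrakk>
     \<Longrightarrow> step R elim better flush A s
           (s\<lparr>master := Returned (map (\<lambda>c. outp (proc s c)) [0..<dim_col A])\<rparr>)"
| deliver: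
    "chan s p c = M # Ms
     \<Longrightarrow> step R elim better flush A s
           (upd_proc c (\<lambda>P. P\<lparr>inbox := inbox P @ [M]\<rparr>)
              (s\<lparr>chan := (chan s)(p := (chan s p)(c := Ms))\<rparr>))"
| receive:
    "\<lbrakk>c < dim_col A; phase (proc s c) = Receive; inbox (proc s c) \<noteq> []\<rbrakk>
     \<Longrightarrow> step R elim better flush A s
           (upd_proc c (\<lambda>P. P\<lparr>phase := Select,
                             queue := queue P @ [r. Row r \<leftarrow> inbox P],
                             ended := (ended P \<or> End \<in> set (inbox P)),
                             inbox := []\<rparr>) s)"
| select_none:
    "\<lbrakk>c < dim_col A; phase (proc s c) = Select; queue (proc s c) = []\<rbrakk>
     \<Longrightarrow> step R elim better flush A s (upd_proc c (\<lambda>P. P\<lparr>phase := Eliminate\<rparr>) s)"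
| select_first:
    "\<lbrakk>c < dim_col A; phase (proc s c) = Select; best (better c) t (queue (proc s c));
      pivot (proc s c) = None\<rbrakk>
     \<Longrightarrow> step R elim better flush A s
           (upd_proc c (\<lambda>P. P\<lparr>phase := Eliminate, pivot := Some t,
                             queue := remove1 t (queue P)\<rparr>) s)"
| select_exchange:
    "\<lbrakk>c < dim_col A; phase (proc s c) = Select; best (better c) t (queue (proc s c));
      pivot (proc s c) = Some u; better c t u\<rbrakk>
     \<Longrightarrow> step R elim better flush A s
           (upd_proc c (\<lambda>P. P\<lparr>phase := Eliminate, pivot := Some t,
                             queue := u # remove1 t (queue P)\<rparr>) s)"
| select_keep:
    "\<lbrakk>c < dim_col A; phase (proc s c) = Select; best (better c) t (queue (proc s c));
      pivot (proc s c) = Some u; \<not> better c t u\<rbrakk>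
     \<Longrightarrow> step R elim better flush A s (upd_proc c (\<lambda>P. P\<lparr>phase := Eliminate\<rparr>) s)"
| eliminate_row:
    "\<lbrakk>c < dim_col A; phase (proc s c) = Eliminate; queue (proc s c) = r # Q;
      pivot (proc s c) = Some u; r' = elim r u\<rbrakk>
     \<Longrightarrow> step R elim better flush A s
           (send (dim_col A) (Proc c) (start_col R r') (Row r')
              (upd_proc c (\<lambda>P. P\<lparr>queue := Q\<rparr>) s))"
| eliminate_end:
    "\<lbrakk>c < dim_col A; phase (proc s c) = Eliminate; queue (proc s c) = []\<rbrakk>
     \<Longrightarrow> step R elim better flush A s (upd_proc c (\<lambda>P. P\<lparr>phase := Check\<rparr>) s)"
| check_continue:
    "\<lbrakk>c < dim_col A; phase (proc s c) = Check; \<not> ended (proc s c)\<rbrakk>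
     \<Longrightarrow> step R elim better flush A s (upd_proc c (\<lambda>P. P\<lparr>phase := Receive\<rparr>) s)"
| check_finish:
    "\<lbrakk>c < dim_col A; phase (proc s c) = Check; ended (proc s c); all_delivered (Proc c) s\<rbrakk>
     \<Longrightarrow> step R elim better flush A s
           (send (dim_col A) (Proc c) (Suc c) End
              (upd_proc c (\<lambda>P. P\<lparr>phase := Done, outp := pivot P\<rparr>) s))"

definition result_matrix :: "nat \<Rightarrow> 'a vec option list \<Rightarrow> 'a mat" where
  "result_matrix m os = mat_of_rows m [u. Some u \<leftarrow> os]"

end

theory Submission
  imports Defs
begin

text \<open>Every elimination moves a row to a strictly later column, so a suitable weight of the
  configuration decreases with every step. End messages are never lost, hence a configuration
  without successor has all units done and the result returned. The pivot of \<open>P[c]\<close> starts at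
  column \<open>c\<close>, so the collected pivots are in echelon form. For the row space, the invariant is
  that any submodule containing all rows still present in the system contains a nonzero multiple
  of every row of \<open>A\<close>: if it contains \<open>u\<close> and \<open>\<alpha> r + \<beta> u\<close>, it contains \<open>\<alpha> r\<close>, and the
  vectors \<open>v\<close> for which it contains \<open>\<alpha> v\<close> again form a submodule.\<close>

section \<open>Rows and their start columns\<close>

lemma start_col_nonzero:
  assumes "start_col R r < dim_vec r"
  shows "r $ start_col R r \<noteq> \<zero>\<^bsub>R\<^esub>"
proof -
  have ex: "\<exists>j. j < dim_vec r \<and> r $ j \<noteq> \<zero>\<^bsub>R\<^esub>"
    using assms by (auto simp: start_col_def split: if_splits)
  then show ?thesis
    using LeastI_ex[OF ex] by (auto simp: start_col_def)
qed

lemma start_col_gt: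
  assumes "c < dim_vec r" and "\<And>j. j \<le> c \<Longrightarrow> r $ j = \<zero>\<^bsub>R\<^esub>"
  shows "c < start_col R r"
  using assms start_col_nonzero[of R r] by (meson leI le_less_trans)

lemma zero_if_start_col_ge:
  assumes "dim_vec r \<le> start_col R r" and "j < dim_vec r"
  shows "r $ j = \<zero>\<^bsub>R\<^esub>"
proof (rule ccontr)
  assume nz: "r $ j \<noteq> \<zero>\<^bsub>R\<^esub>"
  then have "start_col R r = (LEAST j. j < dim_vec r \<and> r $ j \<noteq> \<zero>\<^bsub>R\<^esub>)"
    using assms(2) by (auto simp: start_col_def)
  also have "\<dots> \<le> j"
    by (rule Least_le) (use nz assms(2) in auto)
  finally show False using assms by simp
qed

section \<open>Null rows and submodules of the module of rows\<close>

abbreviation zero_row :: "('a, 'b) ring_scheme \<Rightarrow> nat \<Rightarrow> 'a vec" where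
  "zero_row R m \<equiv> vec m (\<lambda>_. \<zero>\<^bsub>R\<^esub>)"

lemma eq_zero_row_if_start_col_ge:
  assumes "r \<in> rows_over R m" and "m \<le> start_col R r"
  shows "r = zero_row R m"
  using assms zero_if_start_col_ge[of r R] by (intro eq_vecI) (auto simp: rows_over_def)

text \<open>Encodes a submodule of the free module of rows of length \<open>m\<close>. Closure under
  two-term combinations covers sums and multiples at once and has the shape of an elimination
  step.\<close>

definition row_closed :: "('a, 'b) ring_scheme \<Rightarrow> nat \<Rightarrow> 'a vec set \<Rightarrow> bool" where
  "row_closed R m S \<longleftrightarrow> S \<subseteq> rows_over R m \<and> zero_row R m \<in> S \<and>
     (\<forall>v \<in> S. \<forall>w \<in> S. \<forall>a \<in> carrier R. \<forall>b \<in> carrier R. row_comb R m a v b w \<in> S)"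

abbreviation scale_row :: "('a, 'b) ring_scheme \<Rightarrow> nat \<Rightarrow> 'a \<Rightarrow> 'a vec \<Rightarrow> 'a vec" where
  "scale_row R m d r \<equiv> vec m (\<lambda>j. d \<otimes>\<^bsub>R\<^esub> r $ j)"

context cring
begin

lemma rows_over_nth: "r \<in> rows_over R m \<Longrightarrow> j < m \<Longrightarrow> r $ j \<in> carrier R"
  by (simp add: rows_over_def)

lemma rows_over_dim: "r \<in> rows_over R m \<Longrightarrow> dim_vec r = m"
  by (auto simp: rows_over_def)

lemma row_closed_scale:
  assumes "row_closed R m S" "v \<in> S" "d \<in> carrier R"
  shows "scale_row R m d v \<in> S"
proof -
  have "v \<in> rows_over R m" using assms by (auto simp: row_closed_def)
  then have "scale_row R m d v = row_comb R m d v \<zero> v"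
    unfolding row_comb_def
    by (intro eq_vecI) (auto simp: assms(3) rows_over_nth)
  then show ?thesis using assms by (auto simp: row_closed_def)
qed

text \<open>Multiplication by \<open>d\<close> commutes with \<open>row_comb\<close> because the
  ring is commutative. The preimage serves to pull a submodule back across an elimination with
  multiplier \<open>d\<close>.\<close>

lemma row_closed_scale_preimage:
  assumes S: "row_closed R m S" and d: "d \<in> carrier R"
  shows "row_closed R m {v \<in> rows_over R m. scale_row R m d v \<in> S}"
  unfolding row_closed_def
proof (intro conjI ballI)
  have "scale_row R m d (zero_row R m) = zero_row R m"
    by (intro eq_vecI) (auto simp: d)
  then show "zero_row R m \<in> {v \<in> rows_over R m. scale_row R m d v \<in> S}"
    using S by (auto simp: row_closed_def rows_over_def)
next
  fix v w a b
  assume v: "v \<in> {v \<in> rows_over R m. scale_row R m d v \<in> S}"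
    and w: "w \<in> {v \<in> rows_over R m. scale_row R m d v \<in> S}"
    and ab: "a \<in> carrier R" "b \<in> carrier R"
  have "scale_row R m d (row_comb R m a v b w)
      = row_comb R m a (scale_row R m d v) b (scale_row R m d w)"
    unfolding row_comb_def
  proof (intro eq_vecI)
    fix j assume "j < dim_vec (vec m (\<lambda>j. a \<otimes> scale_row R m d v $ j \<oplus> b \<otimes> scale_row R m d w $ j))"
    then have j: "j < m" by simp
    have c: "v $ j \<in> carrier R" "w $ j \<in> carrier R" using v w j by (auto simp: rows_over_nth)
    show "scale_row R m d (vec m (\<lambda>j. a \<otimes> v $ j \<oplus> b \<otimes> w $ j)) $ j =
         vec m (\<lambda>j. a \<otimes> scale_row R m d v $ j \<oplus> b \<otimes> scale_row R m d w $ j) $ j"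
      using j c ab d by (simp add: r_distr m_lcomm)
  qed simp
  moreover have "row_comb R m a v b w \<in> rows_over R m"
    using v w ab by (auto simp: rows_over_def row_comb_def)
  ultimately show "row_comb R m a v b w \<in> {v \<in> rows_over R m. scale_row R m d v \<in> S}"
    using v w ab S by (auto simp: row_closed_def)
qed auto

text \<open>Subtracting \<open>b u\<close> from \<open>a r + b u\<close> leaves \<open>a r\<close>.
  Nothing is divided by \<open>a\<close>, so only a multiple of \<open>r\<close> is
  recovered.\<close>

lemma row_closed_cancel:
  assumes S: "row_closed R m S"
    and r: "r \<in> rows_over R m" and u: "u \<in> S" and a: "a \<in> carrier R" "b \<in> carrier R"
    and comb: "row_comb R m a r b u \<in> S"
  shows "scale_row R m a r \<in> S"
proof -
  have u': "u \<in> rows_over R m" using S u by (auto simp: row_closed_def)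
  have "scale_row R m a r = row_comb R m \<one> (row_comb R m a r b u) (\<ominus> b) u"
  proof (intro eq_vecI)
    fix j assume "j < dim_vec (row_comb R m \<one> (row_comb R m a r b u) (\<ominus> b) u)"
    then have j: "j < m" by (simp add: row_comb_def)
    have "r $ j \<in> carrier R" "u $ j \<in> carrier R" using r u' j by (auto simp: rows_over_nth)
    then show "scale_row R m a r $ j = row_comb R m \<one> (row_comb R m a r b u) (\<ominus> b) u $ j"
      using j a by (simp add: row_comb_def l_minus a_assoc r_neg)
  qed (simp add: row_comb_def)
  then show ?thesis using S comb u a by (auto simp: row_closed_def)
qed

text \<open>Applied to \<open>A\<close>, this keeps every computed row in the row module of the
  input; applied to the result, it supplies the submodule against which recoverability is finally
  tested.\<close>

lemma row_closed_row_module: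
  assumes B: "elements_mat B \<subseteq> carrier R"
  shows "row_closed R (dim_col B) (row_module R B)"
proof -
  let ?n = "dim_row B" and ?m = "dim_col B"
  have Bc: "B $$ (i, j) \<in> carrier R" if "i < ?n" "j < ?m" for i j
    using B that by (auto simp: elements_matI)
  show ?thesis
    unfolding row_closed_def
  proof (intro conjI ballI)
    show "row_module R B \<subseteq> rows_over R ?m"
      by (auto simp: row_module_def rows_over_def Pi_def intro!: finsum_closed m_closed Bc)
    have "(\<Oplus>i \<in> {..<?n}. \<zero> \<otimes> B $$ (i, j)) = \<zero>" if "j < ?m" for j
      by (rule add.finprod_one_eqI) (simp add: Bc that)
    then show "zero_row R ?m \<in> row_module R B"
      unfolding row_module_def
      by (intro CollectI exI[of _ "\<lambda>_. \<zero>"]) (auto intro!: eq_vecI)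
  next
    fix v w a b
    assume "v \<in> row_module R B" "w \<in> row_module R B"
    then obtain x y where
      x: "x \<in> {..<?n} \<rightarrow> carrier R" "v = vec ?m (\<lambda>j. \<Oplus>i \<in> {..<?n}. x i \<otimes> B $$ (i, j))" and
      y: "y \<in> {..<?n} \<rightarrow> carrier R" "w = vec ?m (\<lambda>j. \<Oplus>i \<in> {..<?n}. y i \<otimes> B $$ (i, j))"
      by (auto simp: row_module_def)
    assume ab: "a \<in> carrier R" "b \<in> carrier R"
    let ?z = "\<lambda>i. a \<otimes> x i \<oplus> b \<otimes> y i"
    have "row_comb R ?m a v b w = vec ?m (\<lambda>j. \<Oplus>i \<in> {..<?n}. ?z i \<otimes> B $$ (i, j))"
    proof (intro eq_vecI)
      fix j assume "j < dim_vec (vec ?m (\<lambda>j. \<Oplus>i \<in> {..<?n}. ?z i \<otimes> B $$ (i, j)))"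
      then have j: "j < ?m" by simp
      have xi: "x i \<in> carrier R" and yi: "y i \<in> carrier R" if "i < ?n" for i
        using x y that by auto
      have "(\<Oplus>i \<in> {..<?n}. ?z i \<otimes> B $$ (i, j))
          = (\<Oplus>i \<in> {..<?n}. a \<otimes> (x i \<otimes> B $$ (i, j)) \<oplus> b \<otimes> (y i \<otimes> B $$ (i, j)))"
        by (intro finsum_cong') (auto simp: ab xi yi Bc j l_distr m_assoc)
      also have "\<dots> = (\<Oplus>i \<in> {..<?n}. a \<otimes> (x i \<otimes> B $$ (i, j)))
                     \<oplus> (\<Oplus>i \<in> {..<?n}. b \<otimes> (y i \<otimes> B $$ (i, j)))"
        by (intro finsum_addf) (auto simp: ab xi yi Bc j)
      also have "\<dots> = a \<otimes> (\<Oplus>i \<in> {..<?n}. x i \<otimes> B $$ (i, j))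
                     \<oplus> b \<otimes> (\<Oplus>i \<in> {..<?n}. y i \<otimes> B $$ (i, j))"
        by (subst (1 2) finsum_rdistr) (auto simp: ab xi yi Bc j)
      finally show "row_comb R ?m a v b w $ j
          = vec ?m (\<lambda>j. \<Oplus>i \<in> {..<?n}. ?z i \<otimes> B $$ (i, j)) $ j"
        using j by (simp add: row_comb_def x y)
    qed (simp add: row_comb_def)
    moreover have "?z \<in> {..<?n} \<rightarrow> carrier R" using x y ab by auto
    ultimately show "row_comb R ?m a v b w \<in> row_module R B"
      unfolding row_module_def by (intro CollectI exI[of _ ?z] conjI)
  qed
qed

lemma row_in_row_module:
  assumes B: "elements_mat B \<subseteq> carrier R" and i: "i < dim_row B"
  shows "row B i \<in> row_module R B"
proof -
  let ?x = "\<lambda>k. if i = k then \<one> else \<zero>"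
  have Bc: "B $$ (i, j) \<in> carrier R" if "i < dim_row B" "j < dim_col B" for i j
    using B that by (auto simp: elements_matI)
  have "row B i = vec (dim_col B) (\<lambda>j. \<Oplus>k \<in> {..<dim_row B}. ?x k \<otimes> B $$ (k, j))"
  proof (intro eq_vecI)
    fix j assume "j < dim_vec (vec (dim_col B) (\<lambda>j. \<Oplus>k \<in> {..<dim_row B}. ?x k \<otimes> B $$ (k, j)))"
    then have j: "j < dim_col B" by simp
    have "(\<Oplus>k \<in> {..<dim_row B}. ?x k \<otimes> B $$ (k, j))
        = (\<Oplus>k \<in> {..<dim_row B}. if i = k then B $$ (k, j) else \<zero>)"
      by (intro finsum_cong') (auto simp: Bc j)
    also have "\<dots> = B $$ (i, j)"
      by (rule finsum_singleton) (auto simp: Bc i j)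
    finally show "row B i $ j
        = vec (dim_col B) (\<lambda>j. \<Oplus>k \<in> {..<dim_row B}. ?x k \<otimes> B $$ (k, j)) $ j"
      using i j by simp
  qed simp
  moreover have "?x \<in> {..<dim_row B} \<rightarrow> carrier R" by auto
  ultimately show ?thesis
    unfolding row_module_def by (intro CollectI exI[of _ ?x] conjI)
qed

end

section \<open>Echelon form from strictly increasing start columns\<close>

text \<open>The second conjunct strengthens the induction: the row appended for index
  \<open>k\<close> starts at column \<open>k\<close>, beyond the bound on all earlier ones. Nil
  outputs simply vanish from the list.\<close>

lemma strict_sorted_start_col_concat:
  assumes "\<And>c u. c < k \<Longrightarrow> f c = Some u \<Longrightarrow> start_col R u = c"
  shows "sorted_wrt (\<lambda>u v. start_col R u < start_col R v) [u. Some u \<leftarrow> map f [0..<k]]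
    \<and> (\<forall>u \<in> set [u. Some u \<leftarrow> map f [0..<k]]. start_col R u < k)"
  using assms
proof (induction k)
  case (Suc k)
  then have IH: "sorted_wrt (\<lambda>u v. start_col R u < start_col R v) [u. Some u \<leftarrow> map f [0..<k]]"
    "\<forall>u \<in> set [u. Some u \<leftarrow> map f [0..<k]]. start_col R u < k"
    by (metis less_Suc_eq)+
  have "\<And>u. f k = Some u \<Longrightarrow> start_col R u = k" using Suc.prems by simp
  then show ?case
    using IH by (fastforce simp: sorted_wrt_append split: option.splits)
qed simp

text \<open>Strict increase gives the first alternative of \<open>row_echelon\<close> at every
  index, so null rows need no separate treatment.\<close>

lemma row_echelon_mat_of_rows:
  assumes "sorted_wrt (\<lambda>u v. start_col R u < start_col R v) us" "set us \<subseteq> carrier_vec m"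
  shows "row_echelon R (mat_of_rows m us)"
  unfolding row_echelon_def
proof (intro ballI disjI1)
  fix i assume "i \<in> {1..<dim_row (mat_of_rows m us)}"
  then have i: "0 < i" "i < length us" by auto
  then have "row (mat_of_rows m us) i = us ! i" "row (mat_of_rows m us) (i - 1) = us ! (i - 1)"
    using assms(2) by (auto intro!: mat_of_rows_row simp: subset_iff)
  then show "start_col R (row (mat_of_rows m us) i) > start_col R (row (mat_of_rows m us) (i - 1))"
    using sorted_wrt_nth_less[OF assms(1), of "i - 1" i] i by auto
qed


section \<open>Invariants of the message-passing system\<close>

locale rheinfall = domain R for R :: "('a, 'b) ring_scheme" (structure) +
  fixes A :: "'a mat" and elim :: "'a vec \<Rightarrow> 'a vec \<Rightarrow> 'a vec"
    and better :: "nat \<Rightarrow> 'a vec \<Rightarrow> 'a vec \<Rightarrow> bool" and flush :: bool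
  assumes entries: "elements_mat A \<subseteq> carrier R"
    and elim: "eliminates R (dim_col A) (carrier R) elim"
    and better_asymp: "asymp (better c)" and better_transp: "transp (better c)"
begin

abbreviation m :: nat where "m \<equiv> dim_col A"

abbreviation moves :: "'a config \<Rightarrow> 'a config \<Rightarrow> bool" where
  "moves \<equiv> step R elim better flush A"

text \<open>Couples the two properties tracked for rows handled by \<open>P[c]\<close>: the first
  bounds the row space of the result, the second yields its echelon form.\<close>

definition col_rows :: "nat \<Rightarrow> 'a vec set" where
  "col_rows c = {r \<in> row_module R A. start_col R r = c}"

text \<open>The clauses on \<open>Eliminate\<close> and \<open>Receive\<close> exclude deadlock:
  there is a pivot to eliminate by, and a unit that knows of End never waits again. The empty queue
  in \<open>Done\<close> means that no row is left behind.\<close>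

definition unit_ok :: "nat \<Rightarrow> 'a proc_unit \<Rightarrow> bool" where
  "unit_ok c P \<longleftrightarrow>
     {r. Row r \<in> set (inbox P)} \<union> set (queue P) \<union> set_option (pivot P) \<subseteq> col_rows c \<and>
     (phase P = Eliminate \<and> queue P \<noteq> [] \<longrightarrow> pivot P \<noteq> None) \<and>
     (phase P \<in> {Receive, Check, Done} \<longrightarrow> queue P = []) \<and>
     (phase P = Receive \<longrightarrow> \<not> ended P) \<and>
     (phase P = Done \<longrightarrow> ended P \<and> outp P = pivot P)"

text \<open>Units send only to later columns, rows as well as End; the order \<open>q < c\<close> is
  what \<open>earlier_senders_done\<close> relies on.\<close>

definition msg_ok :: "sender \<Rightarrow> nat \<Rightarrow> 'a msg \<Rightarrow> bool" where
  "msg_ok p c M \<longleftrightarrow> c < m \<and> (p = Master \<or> (\<exists>q < c. p = Proc q)) \<and> (\<forall>r. M = Row r \<longrightarrow> r \<in> col_rows c)"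

definition wf_config :: "'a config \<Rightarrow> bool" where
  "wf_config s \<longleftrightarrow> (\<forall>c. unit_ok c (proc s c)) \<and> (\<forall>p c. \<forall>M \<in> set (chan s p c). msg_ok p c M) \<and>
     (\<forall>i. master s = Sending i \<longrightarrow> i \<le> dim_row A)"

lemma row_module_closed: "row_closed R m (row_module R A)"
  using row_closed_row_module[OF entries] .

lemma col_rowsD:
  assumes "r \<in> col_rows c"
  shows "r \<in> row_module R A" "r \<in> rows_over R m" "start_col R r = c" "dim_vec r = m"
  using assms row_module_closed by (auto simp: col_rows_def row_closed_def rows_over_dim)

lemma elim_col_rows:
  assumes "r \<in> col_rows c" "u \<in> col_rows c" "c < m"
  shows "elim r u \<in> row_module R A" "c < start_col R (elim r u)"
proof -
  note r = col_rowsD[OF assms(1)] and u = col_rowsD[OF assms(2)]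
  obtain a b where ab: "a \<in> carrier R" "b \<in> carrier R" "elim r u = row_comb R m a r b u"
    and z: "\<forall>j \<le> c. elim r u $ j = \<zero>"
    using elim r u assms(3) unfolding eliminates_def by metis
  show "elim r u \<in> row_module R A"
    using row_module_closed r u ab by (simp add: row_closed_def)
  show "c < start_col R (elim r u)"
    using z ab assms(3) by (intro start_col_gt) (auto simp: row_comb_def)
qed

lemma wf_send:
  assumes "wf_config s" and "c < m \<Longrightarrow> msg_ok p c M"
  shows "wf_config (send m p c M s)"
  using assms by (auto simp: wf_config_def send_def)

lemma wf_upd_proc:
  assumes "wf_config s" and "unit_ok c (f (proc s c))"
  shows "wf_config (upd_proc c f s)"
  using assms by (auto simp: wf_config_def)

lemma wf_master:
  assumes "wf_config s" and "\<And>i. x = Sending i \<Longrightarrow> i \<le> dim_row A"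
  shows "wf_config (s\<lparr>master := x\<rparr>)"
  using assms by (auto simp: wf_config_def)

lemma wf_initial: "wf_config initial"
  by (auto simp: wf_config_def initial_def unit_ok_def)

lemma wf_step:
  assumes st: "moves s s'" and wf: "wf_config s"
  shows "wf_config s'"
proof -
  have u: "unit_ok c (proc s c)" for c using wf by (simp add: wf_config_def)
  show ?thesis
    using st
  proof cases
    case (master_send_row i)
    have "row A i \<in> row_module R A"
      using row_in_row_module[OF entries master_send_row(3)] .
    then show ?thesis
      unfolding master_send_row
      using master_send_row by (intro wf_send wf_master wf) (auto simp: msg_ok_def col_rows_def)
  next
    case master_send_end
    then show ?thesis
      by (auto intro!: wf_send wf_master wf simp: msg_ok_def)
  next
    case (deliver p c M Ms)
    have "msg_ok p c M" and wf': "wf_config (s\<lparr>chan := (chan s)(p := (chan s p)(c := Ms))\<rparr>)"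
      using wf deliver by (auto simp: wf_config_def)
    then show ?thesis
      unfolding deliver(1) using u[of c]
      by (intro wf_upd_proc) (auto simp: unit_ok_def msg_ok_def)
  next
    case (receive c)
    then show ?thesis
      using u[of c] by (auto intro!: wf_upd_proc wf simp: unit_ok_def split: msg.splits)
  next
    case (select_first c t)
    then show ?thesis
      using u[of c] set_remove1_subset[of t "queue (proc s c)"]
      by (auto intro!: wf_upd_proc wf simp: unit_ok_def best_def subset_iff)
  next
    case (select_exchange c t v)
    then show ?thesis
      using u[of c] set_remove1_subset[of t "queue (proc s c)"]
      by (auto intro!: wf_upd_proc wf simp: unit_ok_def best_def subset_iff)
  next
    case (select_keep c t v)
    then show ?thesis
      using u[of c] by (auto intro!: wf_upd_proc wf simp: unit_ok_def)
  next
    case (eliminate_row c r Q v r')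
    have "r \<in> col_rows c" "v \<in> col_rows c"
      using u[of c] eliminate_row by (auto simp: unit_ok_def)
    note e = elim_col_rows[OF this eliminate_row(2)]
    show ?thesis
      unfolding eliminate_row(1)
      using u[of c] eliminate_row(2-) e
      by (intro wf_send wf_upd_proc wf) (auto simp: unit_ok_def msg_ok_def col_rows_def)
  next
    case (check_finish c)
    then show ?thesis
      using u[of c] by (auto intro!: wf_send wf_upd_proc wf simp: unit_ok_def msg_ok_def)
  qed (use u in \<open>auto intro!: wf_master wf_upd_proc wf simp: unit_ok_def\<close>)
qed

subsection \<open>Termination\<close>

abbreviation col_weight :: "nat \<Rightarrow> nat" where "col_weight c \<equiv> 10 * (m - c)"

definition senders :: "sender set" where
  "senders = insert Master (Proc ` {..<m})"

text \<open>The surcharge is 6 in transit, 5 in the inbox and 0 in the queue. Hence delivery costs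
  1, and re-sending an eliminated row stays below the 10 gained by its later column.\<close>

definition chan_weight :: "'a config \<Rightarrow> nat" where
  "chan_weight s = (\<Sum>p \<in> senders. \<Sum>c < m. length (chan s p c) * (col_weight c + 6))"

text \<open>Descends by 1 from \<open>Select\<close> to \<open>Receive\<close>; the climb of 3 back
  to \<open>Select\<close> is paid by a received message. The drop to 0 at \<open>Done\<close> pays
  for the End message sent in that step.\<close>

primrec phase_weight :: "phase \<Rightarrow> nat" where
  "phase_weight Select = 10 * m + 13"
| "phase_weight Eliminate = 10 * m + 12"
| "phase_weight Check = 10 * m + 11"
| "phase_weight Receive = 10 * m + 10"
| "phase_weight Done = 0"

definition unit_weight :: "nat \<Rightarrow> 'a proc_unit \<Rightarrow> nat" where
  "unit_weight c P = length (inbox P) * (col_weight c + 5) + length (queue P) * col_weight c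
     + phase_weight (phase P)"

text \<open>One portion for each unsent row and one for End; each exceeds \<open>10 * m + 6\<close>,
  the largest weight of a message in transit.\<close>

primrec master_weight :: "'a master_state \<Rightarrow> nat" where
  "master_weight (Sending i) = (Suc (dim_row A) - i) * (10 * m + 10)"
| "master_weight Awaiting_End = 2"
| "master_weight Collecting = 1"
| "master_weight (Returned os) = 0"

text \<open>A row loses at least 10 when it moves to a later column; this pays for its delivery and for
  the loop iteration of the unit which it triggers.\<close>

definition config_weight :: "'a config \<Rightarrow> nat" where
  "config_weight s = master_weight (master s) + chan_weight s + (\<Sum>c < m. unit_weight c (proc s c))"

text \<open>The old value is added on the left rather than subtracted on the right, because
  subtraction on \<open>nat\<close> is truncated. The weight equations below keep this form.\<close>

lemma sum_fun_upd:
  fixes h :: "'c \<Rightarrow> 'd \<Rightarrow> nat"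
  assumes "finite S" "x \<in> S"
  shows "(\<Sum>z \<in> S. h z ((f(x := y)) z)) + h x (f x) = (\<Sum>z \<in> S. h z (f z)) + h x y"
proof -
  have "(\<Sum>z \<in> S - {x}. h z ((f(x := y)) z)) = (\<Sum>z \<in> S - {x}. h z (f z))"
    by (intro sum.cong) auto
  then show ?thesis
    using sum.remove[OF assms, of "\<lambda>z. h z ((f(x := y)) z)"] sum.remove[OF assms, of "\<lambda>z. h z (f z)"]
    by simp
qed

lemma config_weight_chan:
  assumes "p \<in> senders" "c < m"
  shows "config_weight (s\<lparr>chan := (chan s)(p := (chan s p)(c := L))\<rparr>)
           + length (chan s p c) * (col_weight c + 6)
         = config_weight s + length L * (col_weight c + 6)"
proof -
  \<comment> \<open>Channels are indexed by sender and then by column, so the update lemma is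
    applied to the outer sum with \<open>?h\<close> and again to the inner sum.\<close>
  let ?h = "\<lambda>(_ :: sender) l. \<Sum>c < m. length (l c) * (col_weight c + 6)"
  have "finite senders" by (simp add: senders_def)
  note sum_fun_upd[OF this assms(1), of ?h "chan s" "(chan s p)(c := L)"]
    sum_fun_upd[of "{..<m}" c "\<lambda>c l. length l * (col_weight c + 6)" "chan s p" L]
  then show ?thesis
    using assms(2) by (simp add: config_weight_def chan_weight_def)
qed

lemma config_weight_send:
  assumes "p \<in> senders"
  shows "config_weight (send m p c M s) \<le> config_weight s + (col_weight c + 6)"
  using config_weight_chan[OF assms, where s = s and c = c and L = "chan s p c @ [M]"] by (auto simp: send_def)

lemma config_weight_upd_proc:
  assumes "c < m"
  shows "config_weight (upd_proc c f s) + unit_weight c (proc s c)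
         = config_weight s + unit_weight c (f (proc s c))"
  using sum_fun_upd[of "{..<m}" c unit_weight "proc s" "f (proc s c)"] assms
  by (simp add: config_weight_def chan_weight_def)

lemma config_weight_upd_proc_less:
  assumes "c < m" "unit_weight c (f (proc s c)) < unit_weight c (proc s c)"
  shows "config_weight (upd_proc c f s) < config_weight s"
  using config_weight_upd_proc[OF assms(1), where f = f and s = s] assms(2) by simp

lemma config_weight_master:
  "config_weight (s\<lparr>master := x\<rparr>) + master_weight (master s) = config_weight s + master_weight x"
  by (simp add: config_weight_def chan_weight_def)

text \<open>Well-formedness enters twice: a nonempty channel is one of those counted in
  \<open>chan_weight\<close>, and an eliminated row starts strictly later than the unit's
  column.\<close>

lemma config_weight_step:
  assumes st: "moves s s'" and wf: "wf_config s"
  shows "config_weight s' < config_weight s"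
proof -
  have u: "unit_ok c (proc s c)" for c using wf by (simp add: wf_config_def)
  have M: "Master \<in> senders" by (simp add: senders_def)
  show ?thesis
    using st
  proof cases
    case (master_send_row i)
    have "Suc (dim_row A) - i = Suc (Suc (dim_row A) - Suc i)"
      using master_send_row by simp
    then have "master_weight (master s) = master_weight (Sending (Suc i)) + (10 * m + 10)"
      using master_send_row by simp
    moreover note config_weight_master[where s = s and x = "Sending (Suc i)"]
      config_weight_send[OF M, where c = "start_col R (row A i)" and M = "Row (row A i)" and s = "s\<lparr>master := Sending (Suc i)\<rparr>"]
    ultimately show ?thesis unfolding master_send_row(1) by linarith
  next
    case master_send_end
    have "master_weight (master s) = 10 * m + 10"
      using master_send_end by simp
    moreover note config_weight_master[where s = s and x = Awaiting_End]
      config_weight_send[OF M, where c = 0 and M = End and s = "s\<lparr>master := Awaiting_End\<rparr>"]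
    ultimately show ?thesis unfolding master_send_end(1) by simp
  next
    case master_await_end
    then show ?thesis using config_weight_master[where s = s and x = Collecting] by simp
  next
    case master_collect
    then show ?thesis
      using config_weight_master[where s = s and x = "Returned (map (\<lambda>c. outp (proc s c)) [0..<m])"] by simp
  next
    case (deliver p c M Ms)
    have "msg_ok p c M" using wf deliver by (auto simp: wf_config_def)
    then have pc: "p \<in> senders" "c < m" by (auto simp: msg_ok_def senders_def)
    show ?thesis
      unfolding deliver(1)
      using config_weight_chan[OF pc, where s = s and L = Ms] deliver(2)
        config_weight_upd_proc[OF pc(2), where f = "\<lambda>P. P\<lparr>inbox := inbox P @ [M]\<rparr>"
          and s = "s\<lparr>chan := (chan s)(p := (chan s p)(c := Ms))\<rparr>"]
      by (simp add: unit_weight_def)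
  next
    case (receive c)
    let ?P = "proc s c"
    \<comment> \<open>The inbox holds at least one message, whose surcharge of 5 covers the climb of
      3 from \<open>Receive\<close> to \<open>Select\<close>.\<close>
    obtain l where l: "length (inbox ?P) = Suc l" using receive by (cases "inbox ?P") auto
    have "length [r. Row r \<leftarrow> ms] \<le> length ms" for ms :: "'a msg list"
      by (induction ms) (auto split: msg.splits)
    from mult_le_mono1[OF this[of "inbox ?P"], of "col_weight c"]
    show ?thesis
      unfolding receive(1) using receive(2-) l
      by (intro config_weight_upd_proc_less) (simp_all add: unit_weight_def add_mult_distrib add_mult_distrib2)
  next
    case (select_none c)
    then show ?thesis by (auto intro!: config_weight_upd_proc_less simp: unit_weight_def)
  next
    case (select_first c t)
    then show ?thesis
      by (auto intro!: config_weight_upd_proc_less simp: unit_weight_def best_def length_remove1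
          less_Suc_eq_le mult_le_mono1)
  next
    case (select_exchange c t v)
    \<comment> \<open>The old pivot takes the place of \<open>t\<close>, so the queue keeps its
      length and the decrease comes from the phase alone.\<close>
    then have "Suc (length (queue (proc s c)) - Suc 0) = length (queue (proc s c))"
      by (auto simp: best_def intro!: Suc_pred)
    then show ?thesis
      using select_exchange
      by (auto intro!: config_weight_upd_proc_less simp: unit_weight_def best_def length_remove1
          simp flip: mult_Suc)
  next
    case (select_keep c)
    then show ?thesis by (auto intro!: config_weight_upd_proc_less simp: unit_weight_def)
  next
    case (eliminate_row c r Q v r')
    have "r \<in> col_rows c" "v \<in> col_rows c"
      using u[of c] eliminate_row by (auto simp: unit_ok_def)
    from elim_col_rows(2)[OF this eliminate_row(2)]
    have "c < start_col R r'" using eliminate_row(6) by simp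
    \<comment> \<open>Because \<open>c < m\<close>, the truncated difference \<open>m - c\<close>
      really drops, also for a null row, whose start column is \<open>m\<close>.\<close>
    with eliminate_row(2) have "col_weight (start_col R r') + 10 \<le> col_weight c"
      by arith
    moreover have "Proc c \<in> senders" using eliminate_row by (simp add: senders_def)
    note config_weight_send[OF this, where c = "start_col R r'" and M = "Row r'"
        and s = "upd_proc c (\<lambda>P. P\<lparr>queue := Q\<rparr>) s"]
    moreover note config_weight_upd_proc[OF eliminate_row(2), where f = "\<lambda>P. P\<lparr>queue := Q\<rparr>" and s = s]
    ultimately show ?thesis
      unfolding eliminate_row(1) using eliminate_row(3,4) by (simp add: unit_weight_def)
  next
    case (eliminate_end c)
    then show ?thesis by (auto intro!: config_weight_upd_proc_less simp: unit_weight_def)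
  next
    case (check_continue c)
    then show ?thesis by (auto intro!: config_weight_upd_proc_less simp: unit_weight_def)
  next
    case (check_finish c)
    have "Proc c \<in> senders" using check_finish by (simp add: senders_def)
    note config_weight_send[OF this, where c = "Suc c" and M = End
        and s = "upd_proc c (\<lambda>P. P\<lparr>phase := Done, outp := pivot P\<rparr>) s"]
    moreover note config_weight_upd_proc[OF check_finish(2), where s = s
        and f = "\<lambda>P. P\<lparr>phase := Done, outp := pivot P\<rparr>"]
    ultimately show ?thesis
      unfolding check_finish(1) using check_finish(3) by (simp add: unit_weight_def)
  qed
qed

text \<open>Each step costs at least 1, so the initial weight bounds the length of every run,
  whatever the interleaving.\<close>

lemma no_infinite_run:
  "\<nexists>\<sigma>. \<sigma> 0 = initial \<and> (\<forall>k. moves (\<sigma> k) (\<sigma> (Suc k)))"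
proof
  assume "\<exists>\<sigma>. \<sigma> 0 = initial \<and> (\<forall>k. moves (\<sigma> k) (\<sigma> (Suc k)))"
  then obtain \<sigma> where \<sigma>: "\<sigma> 0 = initial" "\<And>k. moves (\<sigma> k) (\<sigma> (Suc k))" by blast
  have wf: "wf_config (\<sigma> k)" for k
    by (induction k) (use \<sigma> wf_initial wf_step in auto)
  have "config_weight (\<sigma> k) + k \<le> config_weight (\<sigma> 0)" for k
  proof (induction k)
    case (Suc k)
    then show ?case using config_weight_step[OF \<sigma>(2) wf, of k] by simp
  qed simp
  from this[of "Suc (config_weight (\<sigma> 0))"] show False by simp
qed

subsection \<open>End messages\<close>

text \<open>Expresses that \<open>p\<close> has issued its End message: this happens in the very
  step that leaves \<open>Sending\<close> or enters \<open>Done\<close>.\<close>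

primrec sender_done :: "'a config \<Rightarrow> sender \<Rightarrow> bool" where
  "sender_done s Master \<longleftrightarrow> (\<forall>i. master s \<noteq> Sending i)"
| "sender_done s (Proc q) \<longleftrightarrow> phase (proc s q) = Done"

fun end_sender :: "nat \<Rightarrow> sender" where
  "end_sender 0 = Master"
| "end_sender (Suc q) = Proc q"

definition end_sound :: "'a config \<Rightarrow> bool" where
  "end_sound s \<longleftrightarrow>
     (\<forall>p c. End \<in> set (chan s p c) \<longrightarrow> p = end_sender c \<and> sender_done s p) \<and>
     (\<forall>c. End \<in> set (inbox (proc s c)) \<or> ended (proc s c) \<longrightarrow> sender_done s (end_sender c))"

text \<open>The liveness converse of \<open>end_sound\<close>. The bound \<open>c < m\<close>
  matters because the End message of the last unit is dropped.\<close>

definition end_kept :: "'a config \<Rightarrow> bool" where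
  "end_kept s \<longleftrightarrow> (\<forall>c < m. sender_done s (end_sender c) \<longrightarrow>
     End \<in> set (chan s (end_sender c) c) \<or> End \<in> set (inbox (proc s c)) \<or> ended (proc s c))"

text \<open>Only this invariant needs \<open>flush\<close>: an End message is the last one a unit receives.\<close>

definition end_last :: "'a config \<Rightarrow> bool" where
  "end_last s \<longleftrightarrow> (\<forall>p c r. sender_done s p \<longrightarrow> Row r \<notin> set (chan s p c)) \<and>
     (\<forall>c r. ended (proc s c) \<longrightarrow> Row r \<notin> set (inbox (proc s c)))"

text \<open>A unit that is \<open>Done\<close> never changes its pivot again, so the collected
  outputs can be read off the pivots of any later configuration.\<close>

definition returned_ok :: "'a config \<Rightarrow> bool" where
  "returned_ok s \<longleftrightarrow> (\<forall>os. master s = Returned os \<longrightarrow>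
     os = map (\<lambda>c. pivot (proc s c)) [0..<m] \<and> (\<forall>c < m. phase (proc s c) = Done))"

lemma sender_done_step:
  assumes "moves s s'" and "sender_done s p"
  shows "sender_done s' p"
  using assms by (cases; cases p) (auto simp: send_def)

lemma end_sender_eq_iff [simp]:
  "end_sender c = Master \<longleftrightarrow> c = 0" "end_sender c = Proc q \<longleftrightarrow> c = Suc q"
  "Master = end_sender c \<longleftrightarrow> c = 0" "Proc q = end_sender c \<longleftrightarrow> c = Suc q"
  by (cases c; auto)+

text \<open>An End visible after the step was already visible before it, possibly one stage earlier
  on its way, or has just been sent by a sender that became done.\<close>

lemma end_sound_step:
  assumes st: "moves s s'" and inv: "end_sound s"
  shows "end_sound s'"
proof -
  note mono = sender_done_step[OF st]
  have "End \<in> set (chan s p c) \<or> p = end_sender c \<and> sender_done s' p"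
    if "End \<in> set (chan s' p c)" for p c
    using st that by cases (auto simp: send_def all_delivered_def split: if_splits)
  moreover have "(\<exists>p. End \<in> set (chan s p c)) \<or> End \<in> set (inbox (proc s c)) \<or> ended (proc s c)"
    if "End \<in> set (inbox (proc s' c)) \<or> ended (proc s' c)" for c
    using st that
  proof cases
    case (deliver p d M Ms)
    then show ?thesis using that by (auto split: if_splits intro!: exI[of _ p])
  qed (auto simp: send_def split: if_splits)
  ultimately show ?thesis
    using inv mono unfolding end_sound_def by blast
qed


lemma end_kept_step:
  assumes st: "moves s s'" and inv: "end_kept s"
  shows "end_kept s'"
  unfolding end_kept_def
proof (intro allI impI)
  fix c assume c: "c < m" and d: "sender_done s' (end_sender c)"
  show "End \<in> set (chan s' (end_sender c) c) \<or> End \<in> set (inbox (proc s' c)) \<or> ended (proc s' c)"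
  proof (cases "sender_done s (end_sender c)")
    case True
    then have "End \<in> set (chan s (end_sender c) c) \<or> End \<in> set (inbox (proc s c)) \<or> ended (proc s c)"
      using inv c by (auto simp: end_kept_def)
    with st show ?thesis
      by (cases; cases c) (auto simp: send_def split: if_splits)
  next
    \<comment> \<open>The sender became done in this very step, so its End has just entered the
      channel; \<open>c < m\<close> keeps \<open>send\<close> from dropping it.\<close>
    case False
    with st d c show ?thesis
      by (cases; cases c) (auto simp: send_def split: if_splits)
  qed
qed

text \<open>Walks back along the chain of End messages: a unit that is \<open>Done\<close> has
  received End, so its own predecessor is done too, and so on down to the master.\<close>

lemma earlier_senders_done:
  assumes wf: "wf_config s" and inv: "end_sound s"
    and "sender_done s (end_sender c)" and "p = Master \<or> (\<exists>q < c. p = Proc q)"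
  shows "sender_done s p"
  using assms(3,4)
proof (induction c)
  case (Suc c)
  then have "ended (proc s c)" using wf by (auto simp: wf_config_def unit_ok_def)
  then have "sender_done s (end_sender c)" using inv by (auto simp: end_sound_def)
  then show ?case using Suc by (auto simp: less_Suc_eq)
qed simp

lemma end_last_step:
  assumes st: "moves s s'" and flush: flush
    and wf: "wf_config s" and es: "end_sound s" and inv: "end_last s"
  shows "end_last s'"
proof -
  \<comment> \<open>A sender becomes done only after all its messages are delivered, for the master
    by \<open>flush\<close>, and sends no row afterwards.\<close>
  have "sender_done s p \<and> Row r \<in> set (chan s p c)"
    if "sender_done s' p" "Row r \<in> set (chan s' p c)" for p c r
    using st that flush
    by (cases; cases p) (auto simp: send_def all_delivered_def split: if_splits)
  then have "Row r \<notin> set (chan s' p c)" if "sender_done s' p" for p c r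
    using inv that unfolding end_last_def by blast
  \<comment> \<open>Receiving End empties the inbox, so only a later delivery could put a row
    there.\<close>
  moreover have "Row r \<notin> set (inbox (proc s' c))" if "ended (proc s' c)" for c r
    using st
  proof cases
    case (deliver p d M Ms)
    \<comment> \<open>The sender of such a row would already be done, but channels of done senders
      carry no rows.\<close>
    have "M \<noteq> Row r" if "d = c" "ended (proc s c)"
    proof
      assume "M = Row r"
      have "msg_ok p c M" using wf deliver that by (auto simp: wf_config_def)
      moreover have "sender_done s (end_sender c)" using es that by (auto simp: end_sound_def)
      ultimately have "sender_done s p"
        using earlier_senders_done[OF wf es] by (auto simp: msg_ok_def)
      then have "Row r \<notin> set (chan s p d)" using inv unfolding end_last_def by blast
      then show False using deliver \<open>M = Row r\<close> by simp
    qed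
    then show ?thesis
      using deliver \<open>ended (proc s' c)\<close> inv by (auto simp: end_last_def split: if_splits)
  qed (use that inv in \<open>auto simp: end_last_def send_def split: if_splits\<close>)
  ultimately show ?thesis unfolding end_last_def by blast
qed

lemma returned_ok_step:
  assumes st: "moves s s'" and wf: "wf_config s" and inv: "returned_ok s"
  shows "returned_ok s'"
  using st
proof cases
  case master_collect
  then show ?thesis using wf by (auto simp: returned_ok_def wf_config_def unit_ok_def)
qed (use inv in \<open>auto simp: returned_ok_def send_def\<close>)

section \<open>Reachable configurations and absence of deadlock\<close>

lemma reachable_invariants:
  assumes "moves\<^sup>*\<^sup>* initial s"
  shows "wf_config s \<and> end_sound s \<and> end_kept s \<and> (flush \<longrightarrow> end_last s) \<and> returned_ok s"
  using assms
proof induction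
  case base
  have "\<not> sender_done initial (end_sender c)" for c by (cases c) (auto simp: initial_def)
  then show ?case
    using wf_initial
    by (auto simp: end_kept_def) (auto simp: initial_def end_sound_def end_last_def returned_ok_def)
next
  case (step s s')
  then show ?case
    using wf_step[OF step.hyps(2)] end_sound_step[OF step.hyps(2)] end_kept_step[OF step.hyps(2)]
      end_last_step[OF step.hyps(2)] returned_ok_step[OF step.hyps(2)] by simp
qed

text \<open>A best row is a minimal element of the finite set of queued rows, with
  \<open>better c\<close> read as the strict order; asymmetry settles the case
  \<open>r = t\<close>.\<close>

lemma ex_best:
  assumes "Q \<noteq> []"
  shows "\<exists>t. best (better c) t Q"
proof -
  have "\<exists>t \<in> set Q. \<forall>r \<in> set Q. r \<noteq> t \<longrightarrow> \<not> better c r t"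
    using assms better_asymp[of c] better_transp[of c]
    by (intro Finite_Set.bex_min_element) (auto intro: asymp_on_subset transp_on_subset)
  then show ?thesis
    using better_asymp[of c] unfolding best_def by (metis asympD)
qed

text \<open>With no step enabled, channels are empty and each unit is done or idle with an empty
  inbox. The chain of End messages rules out idleness, after which the master could still move
  unless it has returned.\<close>

lemma terminal_returned:
  assumes reach: "moves\<^sup>*\<^sup>* initial s" and stuck: "\<nexists>s'. moves s s'"
  shows "\<exists>os. master s = Returned os"
proof -
  have wf: "wf_config s" and ek: "end_kept s" using reachable_invariants[OF reach] by auto
  have u: "unit_ok c (proc s c)" for c using wf by (simp add: wf_config_def)
  have stuck': "\<not> moves s s'" for s' using stuck by blast
  have chan: "chan s p c = []" for p c
    using stuck' deliver[of s p c] by (cases "chan s p c") blast+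
  have unit: "phase (proc s c) = Done \<or> phase (proc s c) = Receive \<and> inbox (proc s c) = []"
    if c: "c < m" for c
  proof (cases "phase (proc s c)")
    case Receive
    then show ?thesis using stuck' receive[OF c] by blast
  next
    case Select
    show ?thesis
    proof (cases "queue (proc s c) = []")
      case True
      then show ?thesis using stuck' select_none[OF c Select] by blast
    next
      case False
      then obtain t where "best (better c) t (queue (proc s c))" using ex_best by blast
      then show ?thesis
        using stuck' select_first[OF c Select] select_exchange[OF c Select] select_keep[OF c Select]
        by (cases "pivot (proc s c)") blast+
    qed
  next
    case Eliminate
    show ?thesis
    proof (cases "queue (proc s c)")
      case Nil
      then show ?thesis using stuck' eliminate_end[OF c Eliminate] by blast
    next
      case (Cons r Q)
      then obtain v where "pivot (proc s c) = Some v"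
        using u[of c] Eliminate by (auto simp: unit_ok_def)
      then show ?thesis using stuck' eliminate_row[OF c Eliminate Cons] by blast
    qed
  next
    case Check
    have "all_delivered (Proc c) s" using chan by (simp add: all_delivered_def)
    then show ?thesis
      using stuck' check_continue[OF c Check] check_finish[OF c Check] by blast
  qed simp
  have master: "master s \<noteq> Sending i" for i
  proof
    assume i: "master s = Sending i"
    then have "i < dim_row A \<or> i = dim_row A" using wf by (auto simp: wf_config_def)
    moreover have "all_delivered Master s" using chan by (simp add: all_delivered_def)
    ultimately show False
      using stuck' master_send_row[OF i] master_send_end[of s A] i by blast
  qed
  \<comment> \<open>By \<open>end_kept\<close> the End sent by the predecessor is in the inbox or
    recorded; a unit idle in \<open>Receive\<close> admits neither.\<close>
  have all_done: "phase (proc s c) = Done" if "c < m" for c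
    using that
  proof (induction c)
    case 0
    then have "End \<in> set (inbox (proc s 0)) \<or> ended (proc s 0)"
      using ek master chan by (auto simp: end_kept_def)
    then show ?case using unit[OF 0] u[of 0] by (auto simp: unit_ok_def)
  next
    case (Suc c)
    then have "End \<in> set (inbox (proc s (Suc c))) \<or> ended (proc s (Suc c))"
      using ek chan by (fastforce simp: end_kept_def)
    then show ?case using unit[OF Suc.prems] u[of "Suc c"] by (auto simp: unit_ok_def)
  qed
  show ?thesis
  proof (cases "master s")
    case Awaiting_End
    have "ended (proc s (m - 1))" if "0 < m"
      using all_done[of "m - 1"] u[of "m - 1"] that by (auto simp: unit_ok_def)
    then have "moves s (s\<lparr>master := Collecting\<rparr>)"
      using Awaiting_End by (intro master_await_end) auto
    then show ?thesis using stuck' by blast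
  next
    case Collecting
    then show ?thesis using stuck' master_collect[OF Collecting] all_done by blast
  qed (use master in auto)
qed

subsection \<open>The returned matrix\<close>

text \<open>All four facts follow from identifying \<open>os\<close> with the list of pivots, each
  of which lies in \<open>col_rows c\<close> for its own unit.\<close>

lemma returned_pivots:
  assumes reach: "moves\<^sup>*\<^sup>* initial s" and ret: "master s = Returned os"
  defines "us \<equiv> [u. Some u \<leftarrow> os]"
  shows "row_echelon R (result_matrix m os)"
    and "set us \<subseteq> row_module R A"
    and "rows (result_matrix m os) = us"
    and "c < m \<Longrightarrow> pivot (proc s c) = Some u \<Longrightarrow> u \<in> set us"
proof -
  have inv: "wf_config s" "returned_ok s" using reachable_invariants[OF reach] by auto
  then have os: "os = map (\<lambda>c. pivot (proc s c)) [0..<m]"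
    using ret by (auto simp: returned_ok_def)
  have piv: "u \<in> col_rows c" if "pivot (proc s c) = Some u" for c u
    using inv(1) that by (auto simp: wf_config_def unit_ok_def)
  have "\<exists>c. pivot (proc s c) = Some u" if "u \<in> set us" for u
    using that by (auto simp: us_def os split: option.splits)
  then show sub: "set us \<subseteq> row_module R A"
    using piv col_rowsD(1) by blast
  then have car: "set us \<subseteq> carrier_vec m"
    using row_module_closed by (auto simp: row_closed_def rows_over_def)
  then show "rows (result_matrix m os) = us"
    unfolding result_matrix_def us_def by (intro rows_mat_of_rows) auto
  show "row_echelon R (result_matrix m os)"
    unfolding result_matrix_def us_def[symmetric]
    using strict_sorted_start_col_concat[of m "\<lambda>c. pivot (proc s c)" R] piv col_rowsD(3) car
    by (intro row_echelon_mat_of_rows) (auto simp: us_def os)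
  show "c < m \<Longrightarrow> pivot (proc s c) = Some u \<Longrightarrow> u \<in> set us"
    by (force simp: us_def os split: option.splits)
qed

section \<open>Recovering the rows of the input from the result\<close>

definition unit_rows :: "'a proc_unit \<Rightarrow> 'a vec set" where
  "unit_rows P = {r. Row r \<in> set (inbox P)} \<union> set (queue P) \<union> set_option (pivot P)"

text \<open>Rows still to be sent count as well, so that initially every row of \<open>A\<close> is
  present.\<close>

definition present :: "'a config \<Rightarrow> 'a vec set" where
  "present s = {row A i | i k. master s = Sending k \<and> k \<le> i \<and> i < dim_row A} \<union>
     {r. \<exists>p c. Row r \<in> set (chan s p c)} \<union> (\<Union>c < m. unit_rows (proc s c))"

text \<open>Quantifying over all submodules replaces the span of the present rows over the field of
  fractions, and lets an elimination step be handled by changing \<open>S\<close>.\<close>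

definition recoverable :: "'a config \<Rightarrow> bool" where
  "recoverable s \<longleftrightarrow> (\<forall>S. row_closed R m S \<and> present s \<subseteq> S \<longrightarrow>
     (\<forall>r \<in> set (rows A). \<exists>d \<in> carrier R - {\<zero>}. scale_row R m d r \<in> S))"

lemma present_rows_over:
  assumes "wf_config s"
  shows "present s \<subseteq> rows_over R m"
proof -
  have "row A i \<in> rows_over R m" if "i < dim_row A" for i
    using row_in_row_module[OF entries that] row_module_closed by (auto simp: row_closed_def)
  moreover have "r \<in> rows_over R m" if "Row r \<in> set (chan s p c)" for p c r
    using assms that col_rowsD(2) unfolding wf_config_def msg_ok_def by blast
  moreover have "unit_rows (proc s c) \<subseteq> col_rows c" for c
    using assms unfolding wf_config_def unit_ok_def unit_rows_def by blast
  then have "r \<in> rows_over R m" if "r \<in> unit_rows (proc s c)" for c r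
    using that col_rowsD(2) by blast
  ultimately show ?thesis
    unfolding present_def by auto
qed

lemma present_send:
  "present (send m p c M s) = present s \<union> (if c < m then {r. M = Row r} else {})"
  by (auto simp: present_def send_def split: if_splits)

lemma present_upd_proc:
  assumes "unit_rows (proc s c) \<subseteq> unit_rows (f (proc s c))"
  shows "present s \<subseteq> present (upd_proc c f s)"
proof -
  have "unit_rows (proc s d) \<subseteq> unit_rows (proc (upd_proc c f s) d)" for d
    using assms by simp
  then show ?thesis
    unfolding present_def by (intro Un_mono UN_mono) auto
qed

text \<open>Null rows are dropped by \<open>send\<close>; losing them is harmless because every
  submodule contains \<open>zero_row R m\<close>.\<close>

lemma recoverable_mono:
  assumes "recoverable s" and "present s \<subseteq> insert (zero_row R m) (present s')"
  shows "recoverable s'"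
  unfolding recoverable_def
proof (intro allI impI)
  fix S assume S: "row_closed R m S \<and> present s' \<subseteq> S"
  then have "present s \<subseteq> S" using assms(2) by (auto simp: row_closed_def)
  then show "\<forall>r \<in> set (rows A). \<exists>d \<in> carrier R - {\<zero>}. scale_row R m d r \<in> S"
    using assms(1) S unfolding recoverable_def by simp
qed

lemma recoverable_upd_proc:
  assumes "recoverable s" and "unit_rows (proc s c) \<subseteq> unit_rows (f (proc s c))"
  shows "recoverable (upd_proc c f s)"
  using recoverable_mono[OF assms(1) subset_insertI2[OF present_upd_proc[where f = f, OF assms(2)]]] .

lemma recoverable_send: "recoverable s \<Longrightarrow> recoverable (send m p c M s)"
  by (rule recoverable_mono) (auto simp: present_send)

lemma recoverable_master:
  assumes "recoverable s" and "\<And>i. master s = Sending i \<Longrightarrow> dim_row A \<le> i"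
  shows "recoverable (s\<lparr>master := x\<rparr>)"
  using assms(1) by (rule recoverable_mono) (use assms(2) in \<open>fastforce simp: present_def\<close>)

text \<open>Only elimination replaces a row by another one; every other step keeps all present rows
  up to null ones, so monotonicity suffices.\<close>

lemma recoverable_step:
  assumes st: "moves s s'" and elim': "eliminates R m (carrier R - {\<zero>}) elim"
    and wf: "wf_config s" and inv: "recoverable s"
  shows "recoverable s'"
proof -
  have u: "unit_ok c (proc s c)" for c using wf by (simp add: wf_config_def)
  show ?thesis
    using st
  proof cases
    case (master_send_row i)
    have r: "row A i \<in> rows_over R m"
      using row_in_row_module[OF entries master_send_row(3)] row_module_closed
      by (auto simp: row_closed_def)
    have "present s \<subseteq> insert (row A i) (present (s\<lparr>master := Sending (Suc i)\<rparr>))"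
      using master_send_row by (auto simp: present_def) (metis Suc_leI le_neq_implies_less)
    then show ?thesis
      unfolding master_send_row(1)
      using eq_zero_row_if_start_col_ge[OF r]
      by (intro recoverable_mono[OF inv]) (auto simp: present_send)
  next
    case master_send_end
    then show ?thesis
      by (auto intro!: recoverable_send recoverable_master inv)
  next
    case (deliver p c M Ms)
    have "msg_ok p c M" using wf deliver by (auto simp: wf_config_def)
    \<comment> \<open>\<open>present\<close> inspects only units below \<open>m\<close>, so the row
      must arrive at one of these.\<close>
    then have "c < m" by (simp add: msg_ok_def)
    have "Row r \<in> set (chan s' q d) \<or> d = c \<and> M = Row r" if "Row r \<in> set (chan s q d)" for r q d
      using that deliver by auto
    moreover have "unit_rows (proc s d) \<subseteq> unit_rows (proc s' d)" for d
      using deliver by (auto simp: unit_rows_def)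
    moreover have "r \<in> unit_rows (proc s' c)" if "M = Row r" for r
      using that deliver by (auto simp: unit_rows_def)
    moreover have "master s' = master s" using deliver by simp
    ultimately have "present s \<subseteq> present s'"
      using \<open>c < m\<close> unfolding present_def by auto blast+
    then show ?thesis by (intro recoverable_mono[OF inv]) auto
  next
    case (eliminate_row c r Q v r')
    have rv: "r \<in> col_rows c" "v \<in> col_rows c"
      using u[of c] eliminate_row by (auto simp: unit_ok_def)
    note r = col_rowsD[OF rv(1)] and v = col_rowsD[OF rv(2)]
    obtain a b where ab: "a \<in> carrier R - {\<zero>}" "b \<in> carrier R" "r' = row_comb R m a r b v"
      using elim' r v eliminate_row(2,6) unfolding eliminates_def by metis
    have r': "r' \<in> rows_over R m"
      using elim_col_rows(1)[OF rv eliminate_row(2)] row_module_closed eliminate_row(6)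
      by (auto simp: row_closed_def)
    let ?t = "upd_proc c (\<lambda>P. P\<lparr>queue := Q\<rparr>) s"
    have "unit_rows (proc s d) \<subseteq> insert r (unit_rows (proc ?t d))" for d
      using eliminate_row(4) by (auto simp: unit_rows_def)
    then have "present s \<subseteq> insert r (present ?t)"
      unfolding present_def by simp blast
    then have pres: "present s \<subseteq> insert r (present s')"
      unfolding eliminate_row(1) by (auto simp: present_send)
    have v_in: "v \<in> present s'"
      unfolding eliminate_row(1) using eliminate_row(2-)
      by (auto simp: present_send) (auto simp: present_def unit_rows_def)
    have r'_in: "r' \<in> insert (zero_row R m) (present s')"
      unfolding eliminate_row(1) using eq_zero_row_if_start_col_ge[OF r']
      by (auto simp: present_send)
    show ?thesis
      unfolding recoverable_def
    proof (intro allI impI ballI)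
      fix S x
      assume S: "row_closed R m S \<and> present s' \<subseteq> S" and x: "x \<in> set (rows A)"
      \<comment> \<open>\<open>?S\<close> contains \<open>r\<close> by cancellation and the other
        old rows by closure under multiples. The invariant of \<open>s\<close> for \<open>?S\<close>
        gives a denominator \<open>d\<close>, hence \<open>a \<otimes> d\<close> for
        \<open>S\<close>, nonzero in an integral domain.\<close>
      let ?S = "{v \<in> rows_over R m. scale_row R m a v \<in> S}"
      have "scale_row R m a r \<in> S"
        using S v_in r'_in ab r by (intro row_closed_cancel[of _ S r v]) (auto simp: row_closed_def)
      then have "present s \<subseteq> ?S"
        using pres S ab present_rows_over[OF wf] row_closed_scale[of m S] by blast
      moreover have "row_closed R m ?S"
        using S ab by (intro row_closed_scale_preimage) auto
      ultimately obtain d where d: "d \<in> carrier R - {\<zero>}" "scale_row R m d x \<in> ?S"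
        using inv x unfolding recoverable_def by meson
      have "x \<in> rows_over R m"
        using x row_in_row_module[OF entries] row_module_closed
        by (auto simp: row_closed_def rows_def)
      then have "scale_row R m a (scale_row R m d x) = scale_row R m (a \<otimes> d) x"
        using ab d by (intro eq_vecI) (auto simp: m_assoc rows_over_nth)
      moreover have "a \<otimes> d \<in> carrier R - {\<zero>}"
        using ab d by (auto simp: integral_iff)
      ultimately show "\<exists>d \<in> carrier R - {\<zero>}. scale_row R m d x \<in> S"
        using d(2) by (intro bexI[of _ "a \<otimes> d"]) simp_all
    qed
  next
    case (receive c)
    then show ?thesis
      by (auto intro!: recoverable_upd_proc inv simp: unit_rows_def split: msg.splits)
  next
    case (select_first c t)
    then show ?thesis
      using in_set_remove1[of _ t "queue (proc s c)"]
      by (auto intro!: recoverable_upd_proc inv simp: unit_rows_def)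
  next
    case (select_exchange c t v)
    then show ?thesis
      using in_set_remove1[of _ t "queue (proc s c)"]
      by (auto intro!: recoverable_upd_proc inv simp: unit_rows_def)
  qed (auto intro!: recoverable_send recoverable_upd_proc recoverable_master inv simp: unit_rows_def)
qed

lemma recoverable_initial: "recoverable initial"
proof -
  have "set (rows A) \<subseteq> present initial"
    by (auto simp: present_def initial_def rows_def)
  moreover have "scale_row R m \<one> r = r" if "r \<in> set (rows A)" for r
  proof -
    have "r \<in> rows_over R m"
      using that row_in_row_module[OF entries] row_module_closed
      by (auto simp: row_closed_def rows_def)
    then show ?thesis by (intro eq_vecI) (auto simp: rows_over_nth rows_over_dim)
  qed
  ultimately show ?thesis
    unfolding recoverable_def by (intro allI impI ballI bexI[of _ \<one>]) auto
qed

text \<open>At the end channels and inboxes hold no rows and queues are empty, so only pivots remain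
  present. These are the rows of the result, and the invariant is applied with \<open>S\<close> its
  row module.\<close>

lemma returned_recoverable:
  assumes reach: "moves\<^sup>*\<^sup>* initial s" and ret: "master s = Returned os"
    and flush: flush and elim': "eliminates R m (carrier R - {\<zero>}) elim"
  shows "rows_recoverable R A (result_matrix m os)"
proof -
  let ?B = "result_matrix m os"
  have rec: "recoverable s"
    using reach
  proof induction
    case (step s s')
    then show ?case using recoverable_step[OF _ elim'] reachable_invariants by blast
  qed (rule recoverable_initial)
  have inv: "wf_config s" "end_last s" "returned_ok s"
    using reachable_invariants[OF reach] flush by auto
  then have all_done: "phase (proc s c) = Done" if "c < m" for c
    using ret that by (auto simp: returned_ok_def)
  have u: "unit_ok c (proc s c)" for c using inv by (simp add: wf_config_def)
  note piv = returned_pivots[OF reach ret]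
  have dim_B: "dim_col ?B = m" by (simp add: result_matrix_def)
  have B: "elements_mat ?B \<subseteq> carrier R"
  proof
    fix e assume "e \<in> elements_mat ?B"
    then obtain i j where ij: "i < dim_row ?B" "j < m" "e = ?B $$ (i, j)"
      by (auto simp: dim_B)
    then have "row ?B i \<in> set (rows ?B)" by (auto simp: rows_def)
    then have "row ?B i \<in> rows_over R m"
      using piv(2,3) row_module_closed by (auto simp: row_closed_def)
    then show "e \<in> carrier R"
      using rows_over_nth[of "row ?B i" m j] ij dim_B by simp
  qed
  have "Row r \<notin> set (chan s p c)" for r p c
  proof
    assume r: "Row r \<in> set (chan s p c)"
    then have "msg_ok p c (Row r)" using inv(1) by (auto simp: wf_config_def)
    \<comment> \<open>The sender is the master, which has returned, or a unit before column
      \<open>c < m\<close>, which is done.\<close>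
    then have "sender_done s p" using ret all_done by (auto simp: msg_ok_def)
    then show False using r inv(2) by (auto simp: end_last_def)
  qed
  moreover have "unit_rows (proc s c) \<subseteq> set (rows ?B)" if "c < m" for c
    using all_done[OF that] u[of c] inv(2) piv(4)[OF that]
    by (auto simp: unit_rows_def unit_ok_def end_last_def piv(3))
  moreover have "set (rows ?B) \<subseteq> row_module R ?B"
    using row_in_row_module[OF B] by (auto simp: rows_def)
  ultimately have "present s \<subseteq> row_module R ?B"
    using ret by (fastforce simp: present_def)
  moreover have "row_closed R m (row_module R ?B)"
    using row_closed_row_module[OF B] dim_B by simp
  ultimately show ?thesis
    using rec unfolding recoverable_def rows_recoverable_def by blast
qed

end

text \<open>The first two conjuncts give finite time: no run is infinite, and a run can stop only
  with a returned result. Recoverability rules out the loss of rows that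
  \<open>\<alpha> = \<beta> = 0\<close> or an overtaking End could cause.\<close>

theorem theorem1:
  fixes R :: "('a, 'b) ring_scheme"
    and A :: "'a mat"
    and elim :: "'a vec \<Rightarrow> 'a vec \<Rightarrow> 'a vec"
    and better :: "nat \<Rightarrow> 'a vec \<Rightarrow> 'a vec \<Rightarrow> bool"
    and flush :: bool
    and n m :: nat
  assumes "field R \<or> factorial_domain R \<or> principal_domain R"
    and "A \<in> carrier_mat n m" and "elements_mat A \<subseteq> carrier R"
    and "eliminates R m (carrier R) elim"
    and "\<And>c. asymp (better c)" and "\<And>c. transp (better c)"
  shows "(\<nexists>\<sigma>. \<sigma> 0 = initial \<and> (\<forall>k. step R elim better flush A (\<sigma> k) (\<sigma> (Suc k)))) \<and>
    (\<forall>s. (step R elim better flush A)\<^sup>*\<^sup>* initial s \<and> (\<nexists>s'. step R elim better flush A s s') \<longrightarrow>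
         (\<exists>os. master s = Returned os)) \<and>
    (\<forall>s os. (step R elim better flush A)\<^sup>*\<^sup>* initial s \<and> master s = Returned os \<longrightarrow>
         row_echelon R (result_matrix m os) \<and>
         set (rows (result_matrix m os)) \<subseteq> row_module R A \<and>
         (flush \<and> eliminates R m (carrier R - {\<zero>\<^bsub>R\<^esub>}) elim \<longrightarrow>
            rows_recoverable R A (result_matrix m os)))"
proof -
  have "domain R"
    using assms(1) by (auto simp: field.axioms factorial_domain.axioms principal_domain.axioms)
  moreover have m: "m = dim_col A" using assms(2) by simp
  ultimately interpret rheinfall R A elim better flush
    using assms by (intro rheinfall.intro rheinfall_axioms.intro) auto
  show ?thesis
    unfolding m
  proof (intro conjI allI impI)
    show "\<nexists>\<sigma>. \<sigma> 0 = initial \<and> (\<forall>k. step R elim better flush A (\<sigma> k) (\<sigma> (Suc k)))"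
      by (rule no_infinite_run)
  next
    fix s
    assume "(step R elim better flush A)\<^sup>*\<^sup>* initial s \<and> (\<nexists>s'. step R elim better flush A s s')"
    then show "\<exists>os. master s = Returned os" using terminal_returned by blast
  next
    fix s os
    assume "(step R elim better flush A)\<^sup>*\<^sup>* initial s \<and> master s = Returned os"
    then have reach: "(step R elim better flush A)\<^sup>*\<^sup>* initial s" and ret: "master s = Returned os"
      by auto
    show "row_echelon R (result_matrix (dim_col A) os)"
      "set (rows (result_matrix (dim_col A) os)) \<subseteq> row_module R A"
      using returned_pivots[OF reach ret] by simp_all
    assume "flush \<and> eliminates R (dim_col A) (carrier R - {\<zero>\<^bsub>R\<^esub>}) elim"
    then show "rows_recoverable R A (result_matrix (dim_col A) os)"
      using returned_recoverable[OF reach ret] by blast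
  qed
qed

end
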